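(* Let $K\ge 1$ and $p_1,\dots,p_K$ be positive integers, and let $\mathcal{G}_{\mathbf p}^+$ be the group of lists $A=(a,A_1,\dots,A_K)$ with $a>0$ and $A_k\in\mathcal G_{p_k}^+$, under componentwise multiplication. A right invariant measure over the group $\mathcal G_{\mathbf p}^+$ is $$d\nu_r(a,A_1,\dots,A_K)=\frac1a\left(\prod_{k=1}^K\prod_{i=2}^{p_k}A_{k[i,i]}^{\,i-2}\right)d\mu(a,A_1,\dots,A_K),$$ where $d\mu$ is Lebesgue measure over $\mathbb R^+\times\mathcal A_{p_1}\times\cdots\times\mathcal A_{p_K}$, the space of coordinates of $\mathcal G_{\mathbf p}^+$.
   Context: $\mathcal G_{q}^+$ denotes the group (under matrix multiplication) of $q\times q$ real lower triangular matrices with positive diagonal entries and determinant $1$. The group operation on $\mathcal G_{\mathbf p}^+$ is $(a,A_1,\dots,A_K)(t,T_1,\dots,T_K)=(at,A_1T_1,\dots,A_KT_K)$. $A_{k[i,j]}$ is the $(i,j)$ entry of $A_k$. An element $A_k\in\mathcal G_{p_k}^+$ is parameterized by its "free" entries $\{A_{k[i,j]}:2\le i\le p_k,\ 1\le j\le i\}$, with the upper-left entry determined by $A_{k[1,1]}=\prod_{i=2}^{p_k}A_{k[i,i]}^{-1}$. The free entries take values in $\mathcal A_{p_k}=\{a_{i,i}>0,\ a_{i,j}\in\mathbb R:\ 2\le i\le p_k,\ 1\le j<i\}$. Right invariant means invariant under all right translations $A\mapsto AT$, $T\in\mathcal G_{\mathbf p}^+$. *)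

theory Defs
  imports
    "HOL-Analysis.Analysis"
    "HOL-Algebra.Coset"
    "HOL-Algebra.Product_Groups"
    "Jordan_Normal_Form.Determinant"
begin

hide_const (open) Determinants.det Finite_Cartesian_Product.mat

section \<open>The group\<close>

definition lower_triangular_group :: "nat \<Rightarrow> real mat monoid" where
  "lower_triangular_group q =
     \<lparr>carrier = {A \<in> carrier_mat q q.
                   (\<forall>i<q. \<forall>j<q. i < j \<longrightarrow> A $$ (i, j) = 0) \<and>
                   (\<forall>i<q. A $$ (i, i) > 0) \<and>
                   det A = 1},
      monoid.mult = (*),
      one = 1\<^sub>m q\<rparr>"

definition positive_reals :: "real monoid" where
  "positive_reals = \<lparr>carrier = {0<..}, monoid.mult = (*), one = 1\<rparr>"

definition scaled_triangular_group :: "nat \<Rightarrow> (nat \<Rightarrow> nat) \<Rightarrow> (real \<times> (nat \<Rightarrow> real mat)) monoid" where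
  "scaled_triangular_group K p =
     positive_reals \<times>\<times> product_group {1..K} (\<lambda>k. lower_triangular_group (p k))"


section \<open>Coordinates and Lebesgue measure\<close>

text \<open>Coordinates carry matrix positions counted from 1, whereas the entries of a matrix in
  \<^theory>\<open>Jordan_Normal_Form.Matrix\<close> are counted from 0.  The functions that serve as coordinates
  are extensional (\<open>undefined\<close> off the index set), as points of \<^const>\<open>PiM\<close> are.\<close>

definition free_positions :: "nat \<Rightarrow> (nat \<times> nat) set" where
  "free_positions q = {(i, j). 2 \<le> i \<and> i \<le> q \<and> 1 \<le> j \<and> j \<le> i}"

definition free_entries :: "nat \<Rightarrow> (nat \<times> nat \<Rightarrow> real) set" where
  "free_entries q = {x \<in> free_positions q \<rightarrow>\<^sub>E UNIV. \<forall>i\<in>{2..q}. x (i, i) > 0}"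

definition matrix_of_entries :: "nat \<Rightarrow> (nat \<times> nat \<Rightarrow> real) \<Rightarrow> real mat" where
  "matrix_of_entries q x =
     Matrix.mat q q (\<lambda>(r, c).
       if r < c then 0
       else if r = 0 then (\<Prod>i=2..q. inverse (x (i, i)))
       else x (r + 1, c + 1))"

definition coordinate_space ::
    "nat \<Rightarrow> (nat \<Rightarrow> nat) \<Rightarrow> (real \<times> (nat \<Rightarrow> nat \<times> nat \<Rightarrow> real)) set" where
  "coordinate_space K p = {0<..} \<times> (\<Pi>\<^sub>E k\<in>{1..K}. free_entries (p k))"

definition coordinate_lebesgue ::
    "nat \<Rightarrow> (nat \<Rightarrow> nat) \<Rightarrow> (real \<times> (nat \<Rightarrow> nat \<times> nat \<Rightarrow> real)) measure" where
  "coordinate_lebesgue K p =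
     restrict_space
       (lborel \<Otimes>\<^sub>M (\<Pi>\<^sub>M k\<in>{1..K}. \<Pi>\<^sub>M ij\<in>free_positions (p k). lborel))
       (coordinate_space K p)"

definition parametrization ::
    "nat \<Rightarrow> (nat \<Rightarrow> nat) \<Rightarrow> real \<times> (nat \<Rightarrow> nat \<times> nat \<Rightarrow> real) \<Rightarrow> real \<times> (nat \<Rightarrow> real mat)" where
  "parametrization K p = (\<lambda>(a, x). (a, \<lambda>k\<in>{1..K}. matrix_of_entries (p k) (x k)))"

text \<open>The parametrization is a bijection onto the group (\<open>bij_betw_parametrization\<close> below), so
  \<^const>\<open>embed_measure\<close> transports both the Borel sets and Lebesgue measure faithfully.\<close>

definition group_lebesgue :: "nat \<Rightarrow> (nat \<Rightarrow> nat) \<Rightarrow> (real \<times> (nat \<Rightarrow> real mat)) measure" where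
  "group_lebesgue K p = embed_measure (coordinate_lebesgue K p) (parametrization K p)"

definition nu_r :: "nat \<Rightarrow> (nat \<Rightarrow> nat) \<Rightarrow> (real \<times> (nat \<Rightarrow> real mat)) measure" where
  "nu_r K p =
     density (group_lebesgue K p)
       (\<lambda>(a, A). ennreal (1 / a * (\<Prod>k=1..K. \<Prod>i=2..p k. A k $$ (i - 1, i - 1) ^ (i - 2))))"


section \<open>Right invariance\<close>

definition right_invariant_measure :: "('a, 'b) monoid_scheme \<Rightarrow> 'a measure \<Rightarrow> bool" where
  "right_invariant_measure G M \<longleftrightarrow>
     space M = carrier G \<and>
     (\<forall>T\<in>carrier G. \<forall>B\<in>sets M.
        B #>\<^bsub>G\<^esub> T \<in> sets M \<and> emeasure M (B #>\<^bsub>G\<^esub> T) = emeasure M B)"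


section \<open>Basic facts\<close>

lemma group_positive_reals: "group positive_reals"
proof (rule groupI)
  fix x assume "x \<in> carrier positive_reals"
  then show "\<exists>y\<in>carrier positive_reals. y \<otimes>\<^bsub>positive_reals\<^esub> x = \<one>\<^bsub>positive_reals\<^esub>"
    by (intro bexI[of _ "inverse x"]) (auto simp: positive_reals_def)
qed (auto simp: positive_reals_def mult.assoc)

lemma lower_triangular_mult_entry:
  fixes A B :: "real mat"
  assumes A: "A \<in> carrier_mat q q" and B: "B \<in> carrier_mat q q"
    and lA: "\<And>i j. i < q \<Longrightarrow> j < q \<Longrightarrow> i < j \<Longrightarrow> A $$ (i, j) = 0"
    and lB: "\<And>k. k < i \<Longrightarrow> B $$ (k, j) = 0"
    and i: "i < q" and j: "j < q"
  shows "(A * B) $$ (i, j) = A $$ (i, i) * B $$ (i, j)"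
proof -
  have "(A * B) $$ (i, j) = (\<Sum>k=0..<q. A $$ (i, k) * B $$ (k, j))"
    using A B i j by (simp add: scalar_prod_def)
  also have "\<dots> = (\<Sum>k\<in>{i}. A $$ (i, k) * B $$ (k, j))"
  proof (rule sum.mono_neutral_right)
    show "\<forall>k\<in>{0..<q} - {i}. A $$ (i, k) * B $$ (k, j) = 0"
    proof
      fix k assume "k \<in> {0..<q} - {i}"
      then have "k < q" "k < i \<or> i < k" by auto
      then show "A $$ (i, k) * B $$ (k, j) = 0" using lA[of i k] lB[of k] i by auto
    qed
  qed (use i in auto)
  finally show ?thesis by simp
qed

lemma group_lower_triangular_group: "group (lower_triangular_group q)"
proof (rule groupI)
  fix A B
  assume "A \<in> carrier (lower_triangular_group q)" "B \<in> carrier (lower_triangular_group q)"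
  then have A: "A \<in> carrier_mat q q" "\<And>i j. i < q \<Longrightarrow> j < q \<Longrightarrow> i < j \<Longrightarrow> A $$ (i, j) = 0"
      "\<And>i. i < q \<Longrightarrow> A $$ (i, i) > 0" "det A = 1"
    and B: "B \<in> carrier_mat q q" "\<And>i j. i < q \<Longrightarrow> j < q \<Longrightarrow> i < j \<Longrightarrow> B $$ (i, j) = 0"
      "\<And>i. i < q \<Longrightarrow> B $$ (i, i) > 0" "det B = 1"
    by (auto simp: lower_triangular_group_def)
  have eq: "(A * B) $$ (i, j) = A $$ (i, i) * B $$ (i, j)" if "i < q" "j < q" "i \<le> j" for i j
    by (rule lower_triangular_mult_entry) (use A B that in auto)
  have "A * B \<in> carrier_mat q q" using A B by simp
  then show "A \<otimes>\<^bsub>lower_triangular_group q\<^esub> B \<in> carrier (lower_triangular_group q)"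
    using A B by (auto simp: lower_triangular_group_def eq det_mult[OF A(1) B(1)]
        simp del: index_mult_mat(1))
next
  fix A
  assume "A \<in> carrier (lower_triangular_group q)"
  then have A: "A \<in> carrier_mat q q" "\<And>i j. i < q \<Longrightarrow> j < q \<Longrightarrow> i < j \<Longrightarrow> A $$ (i, j) = 0"
      "\<And>i. i < q \<Longrightarrow> A $$ (i, i) > 0" "det A = 1"
    by (auto simp: lower_triangular_group_def)
  have "A \<in> Units (ring_mat TYPE(real) q ())"
    by (rule det_non_zero_imp_unit) (use A in auto)
  then obtain B where B: "B \<in> carrier_mat q q" "A * B = 1\<^sub>m q" "B * A = 1\<^sub>m q"
    by (auto simp: Units_def ring_mat_def)
  have low: "B $$ (i, j) = 0" if "i < q" "j < q" "i < j" for i j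
    using that
  proof (induction i rule: less_induct)
    case (less i)
    have "(A * B) $$ (i, j) = A $$ (i, i) * B $$ (i, j)"
      by (rule lower_triangular_mult_entry) (use A B less in auto)
    then show ?case using A(3)[of i] B less.prems by auto
  qed
  have "B $$ (i, i) > 0" if "i < q" for i
  proof -
    have "(A * B) $$ (i, i) = A $$ (i, i) * B $$ (i, i)"
      by (rule lower_triangular_mult_entry) (use A B low that in auto)
    then have "A $$ (i, i) * B $$ (i, i) = 1" using B that by simp
    then show ?thesis using A(3)[OF that] zero_less_mult_pos[of "A $$ (i, i)" "B $$ (i, i)"] by simp
  qed
  moreover have "det B = 1" using det_mult[OF A(1) B(1)] A B by simp
  ultimately show "\<exists>B\<in>carrier (lower_triangular_group q).
      B \<otimes>\<^bsub>lower_triangular_group q\<^esub> A = \<one>\<^bsub>lower_triangular_group q\<^esub>"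
    using B low by (auto simp: lower_triangular_group_def intro!: bexI[of _ B])
qed (auto simp: lower_triangular_group_def)

lemma group_scaled_triangular_group: "group (scaled_triangular_group K p)"
  unfolding scaled_triangular_group_def
  by (intro DirProd_group product_group group_positive_reals group_lower_triangular_group)

lemma bij_betw_matrix_of_entries:
  assumes "q \<ge> 1"
  shows "bij_betw (matrix_of_entries q) (free_entries q) (carrier (lower_triangular_group q))"
proof (rule bij_betw_byWitness
    [where f' = "\<lambda>A. \<lambda>(i, j)\<in>free_positions q. A $$ (i - 1, j - 1)"])
  have shift: "(\<Prod>i=2..q. f i) = (\<Prod>i=1..<q. f (Suc i))" for f :: "nat \<Rightarrow> real"
  proof -
    have "{2..q} = Suc ` {1..<q}"
      by (simp add: image_Suc_atLeastLessThan atLeastLessThanSuc_atLeastAtMost numeral_2_eq_2)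
    then show ?thesis by (simp only: prod.reindex[OF inj_on_subset[OF inj_Suc subset_UNIV]] comp_def)
  qed
  have det: "det A = A $$ (0, 0) * (\<Prod>i=2..q. A $$ (i - 1, i - 1))"
    if "A \<in> carrier_mat q q" "\<And>i j. i < q \<Longrightarrow> j < q \<Longrightarrow> i < j \<Longrightarrow> A $$ (i, j) = 0"
    for A :: "real mat"
  proof -
    have "det A = (\<Prod>i=0..<q. A $$ (i, i))"
      using that by (subst det_lower_triangular[of q]) (auto simp: prod_list_diag_prod)
    then show ?thesis using assms by (simp add: shift prod.atLeast_Suc_lessThan)
  qed
  show "\<forall>x\<in>free_entries q.
      (\<lambda>(i, j)\<in>free_positions q. matrix_of_entries q x $$ (i - 1, j - 1)) = x"
  proof
    fix x assume x: "x \<in> free_entries q"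
    show "(\<lambda>(i, j)\<in>free_positions q. matrix_of_entries q x $$ (i - 1, j - 1)) = x"
    proof
      fix ij
      show "(\<lambda>(i, j)\<in>free_positions q. matrix_of_entries q x $$ (i - 1, j - 1)) ij = x ij"
        using x by (cases ij; cases "ij \<in> free_positions q")
          (auto simp: free_entries_def free_positions_def matrix_of_entries_def PiE_def extensional_def)
    qed
  qed
  show "\<forall>A\<in>carrier (lower_triangular_group q).
      matrix_of_entries q (\<lambda>(i, j)\<in>free_positions q. A $$ (i - 1, j - 1)) = A"
  proof
    fix A assume "A \<in> carrier (lower_triangular_group q)"
    then have A: "A \<in> carrier_mat q q" "\<And>i j. i < q \<Longrightarrow> j < q \<Longrightarrow> i < j \<Longrightarrow> A $$ (i, j) = 0"
        "\<And>i. i < q \<Longrightarrow> A $$ (i, i) > 0" "det A = 1"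
      by (auto simp: lower_triangular_group_def)
    have "A $$ (0, 0) * (\<Prod>i=2..q. A $$ (i - 1, i - 1)) = 1" using det[OF A(1,2)] A(4) by simp
    then have "A $$ (0, 0) = inverse (\<Prod>i=2..q. A $$ (i - 1, i - 1))"
      by (metis inverse_unique mult.commute)
    also have "\<dots> = (\<Prod>i=2..q. inverse (A $$ (i - 1, i - 1)))"
      by (rule prod_inversef[symmetric, unfolded comp_def])
    finally show "matrix_of_entries q (\<lambda>(i, j)\<in>free_positions q. A $$ (i - 1, j - 1)) = A"
      using A by (intro eq_matI) (auto simp: matrix_of_entries_def free_positions_def intro!: prod.cong)
  qed
  show "matrix_of_entries q ` free_entries q \<subseteq> carrier (lower_triangular_group q)"
  proof (rule image_subsetI)
    fix x assume x: "x \<in> free_entries q"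
    let ?A = "matrix_of_entries q x"
    have A: "?A \<in> carrier_mat q q" "\<And>i j. i < q \<Longrightarrow> j < q \<Longrightarrow> i < j \<Longrightarrow> ?A $$ (i, j) = 0"
      by (auto simp: matrix_of_entries_def)
    have pos: "x (i, i) > 0" if "i \<in> {2..q}" for i
      using x that by (auto simp: free_entries_def)
    have "?A $$ (i, i) > 0" if "i < q" for i
      using that pos by (auto simp: matrix_of_entries_def intro!: prod_pos)
    moreover have "det ?A = 1"
    proof -
      have "det ?A = ?A $$ (0, 0) * (\<Prod>i=2..q. ?A $$ (i - 1, i - 1))"
        by (rule det) (use A in auto)
      moreover have "?A $$ (0, 0) = (\<Prod>i=2..q. inverse (x (i, i)))"
        using assms by (simp add: matrix_of_entries_def)
      moreover have "(\<Prod>i=2..q. ?A $$ (i - 1, i - 1)) = (\<Prod>i=2..q. x (i, i))"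
        by (intro prod.cong) (auto simp: matrix_of_entries_def)
      ultimately have "det ?A = (\<Prod>i=2..q. inverse (x (i, i))) * (\<Prod>i=2..q. x (i, i))"
        by (simp only:)
      also have "\<dots> = (\<Prod>i=2..q. inverse (x (i, i)) * x (i, i))" by (simp add: prod.distrib)
      also have "\<dots> = 1" using pos by (intro prod.neutral) force
      finally show ?thesis .
    qed
    ultimately show "?A \<in> carrier (lower_triangular_group q)"
      using A by (auto simp: lower_triangular_group_def)
  qed
  show "(\<lambda>A. \<lambda>(i, j)\<in>free_positions q. A $$ (i - 1, j - 1)) ` carrier (lower_triangular_group q)
      \<subseteq> free_entries q"
  proof (rule image_subsetI)
    fix A assume "A \<in> carrier (lower_triangular_group q)"
    then have "A $$ (i - 1, i - 1) > 0" if "i \<in> {2..q}" for i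
      using that by (auto simp: lower_triangular_group_def)
    then show "(\<lambda>(i, j)\<in>free_positions q. A $$ (i - 1, j - 1)) \<in> free_entries q"
      by (simp add: free_entries_def free_positions_def)
  qed
qed

lemma bij_betw_parametrization:
  assumes "\<And>k. k \<in> {1..K} \<Longrightarrow> p k \<ge> 1"
  shows "bij_betw (parametrization K p) (coordinate_space K p) (carrier (scaled_triangular_group K p))"
proof -
  have b: "bij_betw (matrix_of_entries (p k)) (free_entries (p k))
      (carrier (lower_triangular_group (p k)))" if "k \<in> {1..K}" for k
    using assms[OF that] by (rule bij_betw_matrix_of_entries)
  have "inj_on (parametrization K p) (coordinate_space K p)"
  proof (rule inj_onI, clarify)
    fix a x b y
    assume ax: "(a, x) \<in> coordinate_space K p" and bY: "(b, y) \<in> coordinate_space K p"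
      and eq: "parametrization K p (a, x) = parametrization K p (b, y)"
    have "x k = y k" if k: "k \<in> {1..K}" for k
    proof (rule inj_onD[OF bij_betw_imp_inj_on[OF b[OF k]]])
      have "(\<lambda>k\<in>{1..K}. matrix_of_entries (p k) (x k)) k = (\<lambda>k\<in>{1..K}. matrix_of_entries (p k) (y k)) k"
        using eq by (simp only: parametrization_def prod.case prod.inject)
      then show "matrix_of_entries (p k) (x k) = matrix_of_entries (p k) (y k)"
        using k by simp
      show "x k \<in> free_entries (p k)" "y k \<in> free_entries (p k)"
        using ax bY k unfolding coordinate_space_def by blast+
    qed
    moreover have "x \<in> (\<Pi>\<^sub>E k\<in>{1..K}. free_entries (p k))" "y \<in> (\<Pi>\<^sub>E k\<in>{1..K}. free_entries (p k))"
      using ax bY by (simp_all add: coordinate_space_def)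
    ultimately have "x = y" by (metis PiE_ext)
    then show "a = b \<and> x = y" using eq by (simp add: parametrization_def)
  qed
  moreover have "parametrization K p ` coordinate_space K p = carrier (scaled_triangular_group K p)"
  proof (intro equalityI subsetI)
    fix g assume "g \<in> parametrization K p ` coordinate_space K p"
    then obtain c where c: "c \<in> coordinate_space K p" "g = parametrization K p c" by blast
    obtain a x where ax: "c = (a, x)" by (cases c)
    have g: "g = parametrization K p (a, x)" "a > 0"
        "x \<in> (\<Pi>\<^sub>E k\<in>{1..K}. free_entries (p k))"
      using c by (simp_all add: ax coordinate_space_def)
    have "matrix_of_entries (p k) (x k) \<in> carrier (lower_triangular_group (p k))"
      if "k \<in> {1..K}" for k
      using bij_betw_apply[OF b[OF that] PiE_mem[OF g(3) that]] .
    then show "g \<in> carrier (scaled_triangular_group K p)"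
      using g(2) by (simp add: g(1) parametrization_def scaled_triangular_group_def
          positive_reals_def)
  next
    fix g assume "g \<in> carrier (scaled_triangular_group K p)"
    then obtain a A where g: "g = (a, A)" "a > 0"
        "A \<in> (\<Pi>\<^sub>E k\<in>{1..K}. carrier (lower_triangular_group (p k)))"
      by (cases g) (auto simp: scaled_triangular_group_def positive_reals_def)
    have "\<forall>k\<in>{1..K}. \<exists>x\<in>free_entries (p k). A k = matrix_of_entries (p k) x"
    proof
      fix k assume k: "k \<in> {1..K}"
      then have "A k \<in> carrier (lower_triangular_group (p k))" using g(3) by (rule PiE_mem[rotated])
      then show "\<exists>x\<in>free_entries (p k). A k = matrix_of_entries (p k) x"
        unfolding bij_betw_imp_surj_on[OF b[OF k], symmetric] by auto
    qed
    then obtain x where x: "\<And>k. k \<in> {1..K} \<Longrightarrow> x k \<in> free_entries (p k) \<and> A k = matrix_of_entries (p k) (x k)"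
      by metis
    have "A = (\<lambda>k\<in>{1..K}. matrix_of_entries (p k) (restrict x {1..K} k))"
    proof
      fix k show "A k = (\<lambda>k\<in>{1..K}. matrix_of_entries (p k) (restrict x {1..K} k)) k"
        using x[of k] PiE_arb[OF g(3), of k] by (cases "k \<in> {1..K}") simp_all
    qed
    moreover have "(a, restrict x {1..K}) \<in> coordinate_space K p"
      using g(2) x by (auto simp: coordinate_space_def)
    ultimately show "g \<in> parametrization K p ` coordinate_space K p"
      by (intro image_eqI[of _ _ "(a, restrict x {1..K})"]) (auto simp: g parametrization_def)
  qed
  ultimately show ?thesis by (simp add: bij_betw_def)
qed

lemma sets_coordinate_space:
  "coordinate_space K p \<in> sets (lborel \<Otimes>\<^sub>M (\<Pi>\<^sub>M k\<in>{1..K}. \<Pi>\<^sub>M ij\<in>free_positions (p k). lborel))"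
proof -
  have "free_entries q \<in> sets (\<Pi>\<^sub>M ij\<in>free_positions q. (lborel :: real measure))" for q
  proof -
    let ?M = "\<Pi>\<^sub>M ij\<in>free_positions q. (lborel :: real measure)"
    have [measurable]: "(\<lambda>x. x (i, i)) \<in> borel_measurable ?M" if "i \<in> {2..q}" for i
      using measurable_component_singleton[of "(i, i)" "free_positions q" "\<lambda>_. lborel :: real measure"] that
      by (simp add: free_positions_def)
    have "free_entries q = {x \<in> space ?M. \<forall>i\<in>{2..q}. x (i, i) > 0}"
      by (simp add: free_entries_def space_PiM)
    also have "\<dots> \<in> sets ?M" by measurable
    finally show ?thesis .
  qed
  then show ?thesis unfolding coordinate_space_def by (intro pair_measureI sets_PiM_I_finite) auto
qed

end

theory Submission
  imports Defs
begin

text \<open>Right translation by \<open>T\<close> sends row \<open>i\<close> of \<open>A\<close> to (row \<open>i\<close> of \<open>A\<close>) times the leading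
  \<open>i \<times> i\<close> block of \<open>T\<close>.  On the free entries it is therefore a linear map, triangular for the
  column order, with Jacobian
  \<open>(\<Prod>i=2..q. \<Prod>j=1..i. T\<^bsub>jj\<^esub>) = (\<Prod>i=2..q. T\<^bsub>ii\<^esub> ^ (i - 2))\<inverse>\<close>, since \<open>det T = 1\<close>.  The density
  \<open>\<Prod>i. A\<^bsub>ii\<^esub> ^ (i - 2)\<close> is multiplied by exactly the inverse factor, and on the scalar component
  \<open>da / a\<close> is invariant under \<open>a \<mapsto> a t\<close>.\<close>

section \<open>Maps that scale a measure\<close>

text \<open>Change of variables in the form "\<open>M\<close> is \<open>c\<close> times its image
  under \<open>\<phi>\<close>"; for an invertible linear map and Lebesgue measure, \<open>c\<close>
  is the absolute determinant. Stating it for nonnegative integrals lets it be iterated through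
  Fubini.\<close>

definition scales_integral :: "'a measure \<Rightarrow> ('a \<Rightarrow> 'a) \<Rightarrow> real \<Rightarrow> bool" where
  "scales_integral M \<phi> c \<longleftrightarrow> \<phi> \<in> M \<rightarrow>\<^sub>M M \<and>
     (\<forall>f\<in>borel_measurable M. (\<integral>\<^sup>+x. f x \<partial>M) = ennreal c * (\<integral>\<^sup>+x. f (\<phi> x) \<partial>M))"

lemma scales_integral_measurable: "scales_integral M \<phi> c \<Longrightarrow> \<phi> \<in> M \<rightarrow>\<^sub>M M"
  by (simp add: scales_integral_def)

lemma nn_integral_scales_integral:
  "scales_integral M \<phi> c \<Longrightarrow> f \<in> borel_measurable M \<Longrightarrow>
    (\<integral>\<^sup>+x. f x \<partial>M) = ennreal c * (\<integral>\<^sup>+x. f (\<phi> x) \<partial>M)"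
  by (simp add: scales_integral_def)

lemma emeasure_scales_integral:
  assumes "scales_integral M \<phi> c" "A \<in> sets M"
  shows "emeasure M A = ennreal c * emeasure M (\<phi> -` A \<inter> space M)"
proof -
  have [measurable]: "\<phi> \<in> M \<rightarrow>\<^sub>M M" using assms(1) by (rule scales_integral_measurable)
  have "emeasure M A = ennreal c * (\<integral>\<^sup>+x. indicator A (\<phi> x) \<partial>M)"
    using nn_integral_scales_integral[OF assms(1), of "indicator A"] assms(2) by simp
  also have "(\<integral>\<^sup>+x. indicator A (\<phi> x) \<partial>M) = (\<integral>\<^sup>+x. indicator (\<phi> -` A \<inter> space M) x \<partial>M)"
    by (intro nn_integral_cong) (auto simp: indicator_def)
  also have "\<dots> = emeasure M (\<phi> -` A \<inter> space M)"
    using assms(2) by (intro nn_integral_indicator) measurable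
  finally show ?thesis .
qed

text \<open>Reduces the integral statement to an equality of measures, which can be checked on
  generating sets such as boxes.\<close>

lemma scales_integralI_scale_measure:
  assumes [measurable]: "\<phi> \<in> M \<rightarrow>\<^sub>M M"
    and "M = scale_measure (ennreal c) (distr M M \<phi>)"
  shows "scales_integral M \<phi> c"
  unfolding scales_integral_def
proof (intro conjI ballI)
  fix f :: "_ \<Rightarrow> ennreal" assume [measurable]: "f \<in> borel_measurable M"
  have "(\<integral>\<^sup>+x. f x \<partial>M) = (\<integral>\<^sup>+x. f x \<partial>scale_measure (ennreal c) (distr M M \<phi>))"
    by (rule arg_cong[OF assms(2)])
  also have "\<dots> = ennreal c * (\<integral>\<^sup>+x. f (\<phi> x) \<partial>M)"
    by (simp add: nn_integral_scale_measure nn_integral_distr)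
  finally show "(\<integral>\<^sup>+x. f x \<partial>M) = ennreal c * (\<integral>\<^sup>+x. f (\<phi> x) \<partial>M)" .
qed fact

text \<open>Induction over the coordinates by increasing rank: no coordinate treated earlier depends on the
  last one, so Fubini reduces the step to an affine substitution in one variable.\<close>

lemma scales_integral_lborel_triangular:
  fixes r :: "'i \<Rightarrow> 'r::linorder" and m :: "'i \<Rightarrow> 'i \<Rightarrow> real"
  assumes "finite I"
    and "\<And>i. i \<in> I \<Longrightarrow> m i i \<noteq> 0"
    and "\<And>i k. i \<in> I \<Longrightarrow> k \<in> I \<Longrightarrow> k \<noteq> i \<Longrightarrow> r i \<le> r k \<Longrightarrow> m i k = 0"
  shows "scales_integral (\<Pi>\<^sub>M i\<in>I. lborel) (\<lambda>x. \<lambda>i\<in>I. \<Sum>k\<in>I. m i k * x k) (\<Prod>i\<in>I. \<bar>m i i\<bar>)"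
  using assms
proof (induction I rule: finite_ranking_induct[where f = r])
  case empty
  show ?case by (auto simp: scales_integral_def PiM_empty nn_integral_count_space_finite
     intro!: nn_integral_cong)
next
  case (insert i I)
  show ?case
  proof (cases "i \<in> I")
    \<comment> \<open>The ranking induction allows \<open>i\<close> to lie in \<open>I\<close>
      already; the claim is then the induction hypothesis itself.\<close>
    case True
    with insert show ?thesis by (simp add: insert_absorb)
  next
    case False
    interpret product_sigma_finite "\<lambda>_. lborel :: real measure" by standard
    let ?M = "\<lambda>I. \<Pi>\<^sub>M i\<in>I. (lborel :: real measure)"
    let ?\<phi> = "\<lambda>I x. \<lambda>i\<in>I. \<Sum>k\<in>I. m i k * x k"
    have IH: "scales_integral (?M I) (?\<phi> I) (\<Prod>i\<in>I. \<bar>m i i\<bar>)"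
      by (intro insert.IH insert.prems) auto
    have m_zero: "m j i = 0" if "j \<in> I" for j
      using insert.prems(2)[of j i] insert.hyps(2)[OF that] that False by auto
    have [measurable]: "?\<phi> J \<in> ?M J \<rightarrow>\<^sub>M ?M J" for J
      by measurable
    note [simp] = insert.hyps(1) False
    show ?thesis
      unfolding scales_integral_def
    proof (intro conjI ballI)
      fix f :: "('i \<Rightarrow> real) \<Rightarrow> ennreal" assume [measurable]: "f \<in> borel_measurable (?M (insert i I))"
      \<comment> \<open>The last coordinate is integrated out first, so that the hypothesis for
        \<open>I\<close> applies to \<open>F\<close>.\<close>
      define F where "F x = (\<integral>\<^sup>+y. f (x(i := y)) \<partial>lborel)" for x
      have [measurable]: "F \<in> borel_measurable (?M I)"
        unfolding F_def by measurable
      have upd: "?\<phi> (insert i I) (x(i := y)) =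
          (?\<phi> I x)(i := (\<Sum>k\<in>I. m i k * x k) + m i i * y)" for x y
      proof
        fix j
        have "(\<Sum>k\<in>I. m j k * (x(i := y)) k) = (\<Sum>k\<in>I. m j k * x k)" for j
          by (intro sum.cong) auto
        then show "?\<phi> (insert i I) (x(i := y)) j =
          ((?\<phi> I x)(i := (\<Sum>k\<in>I. m i k * x k) + m i i * y)) j"
          by (cases "j \<in> I") (auto simp: m_zero)
      qed
      \<comment> \<open>The offset in \<open>upd\<close> depends on \<open>x\<close> alone: for
        fixed \<open>x\<close> the substitution in \<open>y\<close> is affine, and only its slope
        \<open>m i i\<close> contributes a factor.\<close>
      have inner: "F (?\<phi> I x) = ennreal \<bar>m i i\<bar> * (\<integral>\<^sup>+y. f (?\<phi> (insert i I) (x(i := y))) \<partial>lborel)"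
        if x: "x \<in> space (?M I)" for x
      proof -
        have "?\<phi> I x \<in> space (?M I)" by (simp add: space_PiM)
        then have "(\<lambda>y. f ((?\<phi> I x)(i := y))) \<in> borel_measurable borel" by measurable
        then show ?thesis
          unfolding F_def upd
          by (rule nn_integral_real_affine) (simp add: insert.prems(1))
      qed
      have "(\<integral>\<^sup>+x. f x \<partial>?M (insert i I)) = (\<integral>\<^sup>+x. F x \<partial>?M I)"
        unfolding F_def by (intro product_nn_integral_insert) auto
      also have "\<dots> = ennreal (\<Prod>i\<in>I. \<bar>m i i\<bar>) * (\<integral>\<^sup>+x. F (?\<phi> I x) \<partial>?M I)"
        by (intro nn_integral_scales_integral[OF IH]) measurable
      also have "(\<integral>\<^sup>+x. F (?\<phi> I x) \<partial>?M I) =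
          (\<integral>\<^sup>+x. ennreal \<bar>m i i\<bar> * (\<integral>\<^sup>+y. f (?\<phi> (insert i I) (x(i := y))) \<partial>lborel) \<partial>?M I)"
        by (intro nn_integral_cong inner)
      also have "\<dots> = ennreal \<bar>m i i\<bar> * (\<integral>\<^sup>+x. \<integral>\<^sup>+y. f (?\<phi> (insert i I) (x(i := y))) \<partial>lborel \<partial>?M I)"
        by (intro nn_integral_cmult) measurable
      also have "(\<integral>\<^sup>+x. \<integral>\<^sup>+y. f (?\<phi> (insert i I) (x(i := y))) \<partial>lborel \<partial>?M I)
          = (\<integral>\<^sup>+x. f (?\<phi> (insert i I) x) \<partial>?M (insert i I))"
        by (intro product_nn_integral_insert[symmetric]) auto
      finally show "(\<integral>\<^sup>+x. f x \<partial>?M (insert i I)) =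
          ennreal (\<Prod>i\<in>insert i I. \<bar>m i i\<bar>) * (\<integral>\<^sup>+x. f (?\<phi> (insert i I) x) \<partial>?M (insert i I))"
        by (simp add: ennreal_mult' mult_ac abs_mult prod_nonneg)
    qed measurable
  qed
qed

text \<open>The preimage of a box under a coordinatewise map is a box, so the rescaled image measure
  agrees with the product measure on boxes, and boxes determine a finite product of sigma-finite
  measures.\<close>

lemma scales_integral_PiM:
  fixes M :: "'i \<Rightarrow> 'a measure"
  assumes I: "finite I" and M: "\<And>i. sigma_finite_measure (M i)"
    and \<phi>: "\<And>i. i \<in> I \<Longrightarrow> scales_integral (M i) (\<phi> i) (c i)"
    and c: "\<And>i. i \<in> I \<Longrightarrow> 0 \<le> c i"
  shows "scales_integral (PiM I M) (\<lambda>x. \<lambda>i\<in>I. \<phi> i (x i)) (\<Prod>i\<in>I. c i)"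
proof (rule scales_integralI_scale_measure)
  interpret product_sigma_finite M using M by (simp add: product_sigma_finite_def)
  let ?\<Phi> = "\<lambda>x. \<lambda>i\<in>I. \<phi> i (x i)"
  have \<phi>_meas: "\<phi> i \<in> M i \<rightarrow>\<^sub>M M i" if "i \<in> I" for i
    using \<phi>[OF that] by (rule scales_integral_measurable)
  show \<Phi>: "?\<Phi> \<in> PiM I M \<rightarrow>\<^sub>M PiM I M"
    by (intro measurable_restrict measurable_compose[OF _ \<phi>_meas] measurable_component_singleton)
  show "PiM I M = scale_measure (ennreal (\<Prod>i\<in>I. c i)) (distr (PiM I M) (PiM I M) ?\<Phi>)"
  proof (rule PiM_eqI[symmetric])
    fix A assume A: "\<And>i. i \<in> I \<Longrightarrow> A i \<in> sets (M i)"
    have "?\<Phi> -` Pi\<^sub>E I A \<inter> space (PiM I M) = (\<Pi>\<^sub>E i\<in>I. \<phi> i -` A i \<inter> space (M i))"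
      by (auto simp: space_PiM PiE_iff)
    moreover have "\<phi> i -` A i \<inter> space (M i) \<in> sets (M i)" if "i \<in> I" for i
      using \<phi>_meas[OF that] A[OF that] by (rule measurable_sets)
    ultimately have "emeasure (distr (PiM I M) (PiM I M) ?\<Phi>) (Pi\<^sub>E I A) =
        (\<Prod>i\<in>I. emeasure (M i) (\<phi> i -` A i \<inter> space (M i)))"
      using A I \<Phi> by (simp add: emeasure_distr sets_PiM_I_finite emeasure_PiM)
    then show "emeasure (scale_measure (ennreal (\<Prod>i\<in>I. c i)) (distr (PiM I M) (PiM I M) ?\<Phi>)) (Pi\<^sub>E I A)
        = (\<Prod>i\<in>I. emeasure (M i) (A i))"
      using A c by (simp add: emeasure_scales_integral[OF \<phi>] prod.distrib flip: prod_ennreal)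
  qed (use I in auto)
qed

lemma scales_integral_lborel_mult:
  assumes "t > 0"
  shows "scales_integral lborel (\<lambda>a. a * t) t"
  unfolding scales_integral_def
proof (intro conjI ballI)
  fix f :: "real \<Rightarrow> ennreal" assume "f \<in> borel_measurable lborel"
  then have "f \<in> borel_measurable borel" by simp
  from nn_integral_real_affine[OF this, of t 0] assms
  show "(\<integral>\<^sup>+x. f x \<partial>lborel) = ennreal t * (\<integral>\<^sup>+x. f (x * t) \<partial>lborel)"
    by (simp add: mult.commute)
qed simp

text \<open>Fubini: the outer integral is transformed by \<open>\<phi>\<close> first, then the inner
  one by \<open>\<psi>\<close> with the outer point \<open>\<phi> x\<close> fixed.\<close>

lemma scales_integral_pair:
  assumes M: "sigma_finite_measure M" and N: "sigma_finite_measure N"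
    and \<phi>: "scales_integral M \<phi> c" and \<psi>: "scales_integral N \<psi> d" and c: "0 \<le> c"
  shows "scales_integral (M \<Otimes>\<^sub>M N) (map_prod \<phi> \<psi>) (c * d)"
  unfolding scales_integral_def
proof (intro conjI ballI)
  interpret M: sigma_finite_measure M by fact
  interpret N: sigma_finite_measure N by fact
  have [measurable]: "\<phi> \<in> M \<rightarrow>\<^sub>M M" "\<psi> \<in> N \<rightarrow>\<^sub>M N"
    using \<phi> \<psi> by (auto dest: scales_integral_measurable)
  show [measurable]: "map_prod \<phi> \<psi> \<in> M \<Otimes>\<^sub>M N \<rightarrow>\<^sub>M M \<Otimes>\<^sub>M N"
    unfolding map_prod_def by measurable
  fix f :: "_ \<Rightarrow> ennreal" assume [measurable]: "f \<in> borel_measurable (M \<Otimes>\<^sub>M N)"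
  have "(\<integral>\<^sup>+z. f z \<partial>(M \<Otimes>\<^sub>M N)) = (\<integral>\<^sup>+x. \<integral>\<^sup>+y. f (x, y) \<partial>N \<partial>M)"
    by (rule N.nn_integral_fst[symmetric]) measurable
  also have "\<dots> = ennreal c * (\<integral>\<^sup>+x. \<integral>\<^sup>+y. f (\<phi> x, y) \<partial>N \<partial>M)"
    by (rule nn_integral_scales_integral[OF \<phi>]) measurable
  also have "(\<integral>\<^sup>+x. \<integral>\<^sup>+y. f (\<phi> x, y) \<partial>N \<partial>M) =
      (\<integral>\<^sup>+x. ennreal d * (\<integral>\<^sup>+y. f (\<phi> x, \<psi> y) \<partial>N) \<partial>M)"
  proof (rule nn_integral_cong)
    fix x assume "x \<in> space M"
    then have "\<phi> x \<in> space M" by (rule measurable_space[rotated]) measurable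
    then have "(\<lambda>y. f (\<phi> x, y)) \<in> borel_measurable N" by measurable
    then show "(\<integral>\<^sup>+y. f (\<phi> x, y) \<partial>N) = ennreal d * (\<integral>\<^sup>+y. f (\<phi> x, \<psi> y) \<partial>N)"
      by (rule nn_integral_scales_integral[OF \<psi>])
  qed
  also have "\<dots> = ennreal d * (\<integral>\<^sup>+x. \<integral>\<^sup>+y. f (\<phi> x, \<psi> y) \<partial>N \<partial>M)"
    by (rule nn_integral_cmult) measurable
  also have "(\<integral>\<^sup>+x. \<integral>\<^sup>+y. f (\<phi> x, \<psi> y) \<partial>N \<partial>M) =
      (\<integral>\<^sup>+x. \<integral>\<^sup>+y. f (map_prod \<phi> \<psi> (x, y)) \<partial>N \<partial>M)" by simp
  also have "\<dots> = (\<integral>\<^sup>+z. f (map_prod \<phi> \<psi> z) \<partial>(M \<Otimes>\<^sub>M N))"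
    by (rule N.nn_integral_fst) measurable
  finally show "(\<integral>\<^sup>+z. f z \<partial>(M \<Otimes>\<^sub>M N)) = ennreal (c * d) * (\<integral>\<^sup>+z. f (map_prod \<phi> \<psi> z) \<partial>(M \<Otimes>\<^sub>M N))"
    using c by (simp add: ennreal_mult' mult.assoc)
qed

text \<open>Factor \<open>i\<close> of the first product is the leading \<open>i \<times> i\<close> minor of a triangular matrix with
  diagonal \<open>t\<close>, the determinant by which right translation acts on row \<open>i\<close>.\<close>

lemma prod_leading_minors:
  fixes t :: "nat \<Rightarrow> real"
  assumes "q \<ge> 1"
  shows "(\<Prod>i=2..q. \<Prod>j=1..i. t j) * (\<Prod>i=2..q. t i ^ (i - 2)) = (\<Prod>j=1..q. t j) ^ (q - 1)"
  using assms
proof (induction q rule: dec_induct)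
  case base
  show ?case by simp
next
  case (step q)
  have "(\<Prod>i=2..Suc q. \<Prod>j=1..i. t j) * (\<Prod>i=2..Suc q. t i ^ (i - 2)) =
      (\<Prod>j=1..Suc q. t j) * t (Suc q) ^ (q - 1) *
      ((\<Prod>i=2..q. \<Prod>j=1..i. t j) * (\<Prod>i=2..q. t i ^ (i - 2)))"
    using step.hyps by (simp add: prod.cl_ivl_Suc mult_ac)
  \<comment> \<open>The power of \<open>t (Suc q)\<close> split off above is what turns
    \<open>(\<Prod>j=1..q. t j) ^ (q - 1)\<close> into the same power of the product up to
    \<open>Suc q\<close>.\<close>
  also have "\<dots> = (\<Prod>j=1..Suc q. t j) * (\<Prod>j=1..Suc q. t j) ^ (q - 1)"
    unfolding step.IH using step.hyps by (simp add: power_mult_distrib mult_ac)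
  also have "\<dots> = (\<Prod>j=1..Suc q. t j) ^ (Suc q - 1)"
    using step.hyps by (cases q) simp_all
  finally show ?case .
qed

section \<open>Triangular matrices and their free positions\<close>

lemma lower_triangular_groupD:
  assumes "A \<in> carrier (lower_triangular_group q)"
  shows "A \<in> carrier_mat q q" "\<And>i j. i < q \<Longrightarrow> j < q \<Longrightarrow> i < j \<Longrightarrow> A $$ (i, j) = 0"
    "\<And>i. i < q \<Longrightarrow> A $$ (i, i) > 0" "det A = 1"
  using assms by (auto simp: lower_triangular_group_def)

lemma finite_free_positions [simp]: "finite (free_positions q)"
  by (rule finite_subset[of _ "{..q} \<times> {..q}"]) (auto simp: free_positions_def)

lemma free_positions_Sigma: "free_positions q = (SIGMA i:{2..q}. {1..i})"
  by (auto simp: free_positions_def)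

section \<open>Right translations in coordinates\<close>

text \<open>Written as one coefficient matrix over all free positions, to match
  \<open>scales_integral_lborel_triangular\<close>. Coefficients between different rows vanish, so
  each row is mapped on its own. The \<open>- 1\<close> converts positions to matrix
  indices.\<close>

definition entries_translation :: "nat \<Rightarrow> real mat \<Rightarrow> (nat \<times> nat \<Rightarrow> real) \<Rightarrow> nat \<times> nat \<Rightarrow> real" where
  "entries_translation q T x =
     (\<lambda>ij\<in>free_positions q. \<Sum>kl\<in>free_positions q.
        (if fst kl = fst ij then T $$ (snd kl - 1, snd ij - 1) else 0) * x kl)"

lemma entries_translation_eq:
  assumes "(i, j) \<in> free_positions q"
  shows "entries_translation q T x (i, j) = (\<Sum>l=1..i. x (i, l) * T $$ (l - 1, j - 1))"
proof -
  have i: "i \<in> {2..q}" using assms by (simp add: free_positions_def)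
  have "entries_translation q T x (i, j) =
      (\<Sum>k\<in>{2..q}. \<Sum>l\<in>{1..k}. (if k = i then T $$ (l - 1, j - 1) else 0) * x (k, l))"
    using assms by (simp add: entries_translation_def free_positions_Sigma sum.Sigma case_prod_unfold
        cong: if_cong)
  also have "\<dots> = (\<Sum>k\<in>{2..q}. if k = i then \<Sum>l=1..i. x (i, l) * T $$ (l - 1, j - 1) else 0)"
    by (intro sum.cong) (auto simp: mult.commute)
  also have "\<dots> = (\<Sum>l=1..i. x (i, l) * T $$ (l - 1, j - 1))"
    using i by simp
  finally show ?thesis .
qed

text \<open>In the sum over \<open>l \<le> i\<close>, the entries of \<open>T\<close> with
  \<open>l < i\<close> lie above the diagonal and vanish.\<close>

lemma entries_translation_diagonal:
  assumes T: "T \<in> carrier (lower_triangular_group q)" and i: "i \<in> {2..q}"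
  shows "entries_translation q T x (i, i) = x (i, i) * T $$ (i - 1, i - 1)"
proof -
  have "entries_translation q T x (i, i) = (\<Sum>l=1..i. x (i, l) * T $$ (l - 1, i - 1))"
    using i by (intro entries_translation_eq) (simp add: free_positions_def)
  also have "\<dots> = (\<Sum>l\<in>{i}. x (i, l) * T $$ (l - 1, i - 1))"
  proof (rule sum.mono_neutral_right)
    show "\<forall>l\<in>{1..i} - {i}. x (i, l) * T $$ (l - 1, i - 1) = 0"
      using i lower_triangular_groupD(2)[OF T] by auto
  qed (use i in auto)
  finally show ?thesis by simp
qed

text \<open>The diagonal entries are multiplied by positive numbers, so their signs do not change in
  either direction.\<close>

lemma entries_translation_in_free_entries_iff:
  assumes T: "T \<in> carrier (lower_triangular_group q)" and x: "x \<in> free_positions q \<rightarrow>\<^sub>E UNIV"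
  shows "entries_translation q T x \<in> free_entries q \<longleftrightarrow> x \<in> free_entries q"
proof -
  have "entries_translation q T x \<in> free_positions q \<rightarrow>\<^sub>E UNIV"
    by (simp add: entries_translation_def)
  moreover have "T $$ (i - 1, i - 1) > 0" if "i \<in> {2..q}" for i
    using lower_triangular_groupD(3)[OF T, of "i - 1"] that by auto
  ultimately show ?thesis
    using x by (simp add: free_entries_def entries_translation_diagonal[OF T] zero_less_mult_iff)
      (metis less_asym atLeastAtMost_iff)
qed

text \<open>The upper left entry is never computed: the product lies in the group, hence comes from
  some free entries \<open>y\<close>, and it remains to compare \<open>y\<close> with the translated
  entries at the free positions.\<close>

lemma matrix_of_entries_translation:
  assumes q: "q \<ge> 1" and T: "T \<in> carrier (lower_triangular_group q)" and x: "x \<in> free_entries q"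
  shows "matrix_of_entries q (entries_translation q T x) = matrix_of_entries q x * T"
proof -
  interpret group "lower_triangular_group q" by (rule group_lower_triangular_group)
  note bij = bij_betw_matrix_of_entries[OF q]
  have X: "matrix_of_entries q x \<in> carrier (lower_triangular_group q)"
    using bij x by (rule bij_betw_apply)
  have "matrix_of_entries q x * T \<in> carrier (lower_triangular_group q)"
    using m_closed[OF X T] by (simp add: lower_triangular_group_def)
  then obtain y where y: "y \<in> free_entries q" "matrix_of_entries q y = matrix_of_entries q x * T"
    using bij_betw_imp_surj_on[OF bij] by (metis imageE)
  have "y = entries_translation q T x"
  proof
    fix ij :: "nat \<times> nat"
    obtain i j where ij: "ij = (i, j)" by (cases ij)
    show "y ij = entries_translation q T x ij"
    proof (cases "ij \<in> free_positions q")
      case True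
      then have bounds: "2 \<le> i" "i \<le> q" "1 \<le> j" "j \<le> i" by (auto simp: ij free_positions_def)
      have "y (i, j) = matrix_of_entries q y $$ (i - 1, j - 1)"
        using bounds by (simp add: matrix_of_entries_def)
      also have "\<dots> = (\<Sum>k=0..<q. matrix_of_entries q x $$ (i - 1, k) * T $$ (k, j - 1))"
        using bounds lower_triangular_groupD(1)[OF T] lower_triangular_groupD(1)[OF X]
        by (simp add: y(2) scalar_prod_def)
      \<comment> \<open>Row \<open>i - 1\<close> of a lower triangular matrix vanishes from column
        index \<open>i\<close> on.\<close>
      also have "\<dots> = (\<Sum>k=0..<i. matrix_of_entries q x $$ (i - 1, k) * T $$ (k, j - 1))"
        using bounds lower_triangular_groupD(2)[OF X] by (intro sum.mono_neutral_right) auto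
      \<comment> \<open>Since \<open>i \<ge> 2\<close>, this is not the first row, so all its
        entries up to the diagonal are free.\<close>
      also have "\<dots> = (\<Sum>k=0..<i. x (i, k + 1) * T $$ (k, j - 1))"
        using bounds by (intro sum.cong) (auto simp: matrix_of_entries_def)
      also have "\<dots> = (\<Sum>l=1..i. x (i, l) * T $$ (l - 1, j - 1))"
        by (rule sum.reindex_bij_witness[of _ "\<lambda>l. l - 1" "\<lambda>k. k + 1"]) auto
      also have "\<dots> = entries_translation q T x (i, j)"
        using True by (simp add: ij entries_translation_eq)
      finally show ?thesis by (simp add: ij)
    next
      \<comment> \<open>Off the free positions both functions are \<open>undefined\<close>.\<close>
      case False
      then show ?thesis
        using y(1) by (auto simp: entries_translation_def free_entries_def)
    qed
  qed
  with y(2) show ?thesis by simp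
qed

lemma scales_integral_entries_translation:
  assumes T: "T \<in> carrier (lower_triangular_group q)"
  shows "scales_integral (\<Pi>\<^sub>M ij\<in>free_positions q. lborel) (entries_translation q T)
    (\<Prod>ij\<in>free_positions q. T $$ (snd ij - 1, snd ij - 1))"
proof -
  let ?m = "\<lambda>ij kl. if fst kl = fst ij then T $$ (snd kl - 1, snd ij - 1) else 0"
  have pos: "T $$ (snd ij - 1, snd ij - 1) > 0" if "ij \<in> free_positions q" for ij
    using that by (intro lower_triangular_groupD(3)[OF T]) (auto simp: free_positions_def)
  have "scales_integral (\<Pi>\<^sub>M ij\<in>free_positions q. lborel)
      (\<lambda>x. \<lambda>ij\<in>free_positions q. \<Sum>kl\<in>free_positions q. ?m ij kl * x kl)
      (\<Prod>ij\<in>free_positions q. \<bar>?m ij ij\<bar>)"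
  \<comment> \<open>The image entry \<open>(i, j)\<close> involves \<open>x (i, l)\<close> only for
    \<open>l \<ge> j\<close>, so columns are treated from right to left; the rank is the negated
    column, hence an integer. Ties between rows are harmless because their coefficients
    vanish.\<close>
  proof (rule scales_integral_lborel_triangular[where r = "\<lambda>ij. - int (snd ij)"])
    fix ij assume "ij \<in> free_positions q"
    from pos[OF this] show "?m ij ij \<noteq> 0" by simp
  next
    fix ij kl
    assume "ij \<in> free_positions q" "kl \<in> free_positions q" "kl \<noteq> ij" "- int (snd ij) \<le> - int (snd kl)"
    then show "?m ij kl = 0"
      by (auto simp: free_positions_def prod_eq_iff intro!: lower_triangular_groupD(2)[OF T])
  qed simp
  also have "(\<Prod>ij\<in>free_positions q. \<bar>?m ij ij\<bar>) = (\<Prod>ij\<in>free_positions q. T $$ (snd ij - 1, snd ij - 1))"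
    using pos by (intro prod.cong) (auto simp: less_imp_le)
  finally show ?thesis unfolding entries_translation_def[abs_def] .
qed

text \<open>The diagonal entry in position \<open>j\<close> enters the Jacobian once per row from
  max(2, j) to \<open>q\<close>: \<open>q - j + 1\<close> times for \<open>j \<ge> 2\<close>, and
  \<open>q - 1\<close> times for \<open>j = 1\<close>. The exponent \<open>j - 2\<close> for
  \<open>j \<ge> 2\<close> brings every total to \<open>q - 1\<close>, so the product is a power of
  \<open>det T = 1\<close>.\<close>

lemma entries_translation_jacobian:
  assumes q: "q \<ge> 1" and T: "T \<in> carrier (lower_triangular_group q)"
  shows "(\<Prod>ij\<in>free_positions q. T $$ (snd ij - 1, snd ij - 1)) *
    (\<Prod>i=2..q. T $$ (i - 1, i - 1) ^ (i - 2)) = 1"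
proof -
  note D = lower_triangular_groupD[OF T]
  have "1 = (\<Prod>i=0..<q. T $$ (i, i))"
    using D det_lower_triangular[of q T] by (simp add: prod_list_diag_prod)
  also have "\<dots> = (\<Prod>i=1..q. T $$ (i - 1, i - 1))"
    by (rule prod.reindex_bij_witness[of _ "\<lambda>l. l - 1" "\<lambda>k. k + 1"]) auto
  finally have "(\<Prod>i=1..q. T $$ (i - 1, i - 1)) = 1" by simp
  with prod_leading_minors[OF q, of "\<lambda>i. T $$ (i - 1, i - 1)"] show ?thesis
    by (simp add: free_positions_Sigma prod.Sigma case_prod_unfold)
qed

section \<open>Translations and density on the full product space\<close>

text \<open>Right multiplication by \<open>T\<close> in coordinates, extended linearly to points
  whose scalar or diagonal entries are not positive, so that the scaling lemmas for full Lebesgue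
  measure apply.\<close>

definition coordinate_translation ::
    "nat \<Rightarrow> (nat \<Rightarrow> nat) \<Rightarrow> real \<times> (nat \<Rightarrow> real mat) \<Rightarrow>
      real \<times> (nat \<Rightarrow> nat \<times> nat \<Rightarrow> real) \<Rightarrow> real \<times> (nat \<Rightarrow> nat \<times> nat \<Rightarrow> real)" where
  "coordinate_translation K p T =
     map_prod (\<lambda>a. a * fst T) (\<lambda>x. \<lambda>k\<in>{1..K}. entries_translation (p k) (snd T k) (x k))"

definition full_lebesgue ::
    "nat \<Rightarrow> (nat \<Rightarrow> nat) \<Rightarrow> (real \<times> (nat \<Rightarrow> nat \<times> nat \<Rightarrow> real)) measure" where
  "full_lebesgue K p = lborel \<Otimes>\<^sub>M (\<Pi>\<^sub>M k\<in>{1..K}. \<Pi>\<^sub>M ij\<in>free_positions (p k). lborel)"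

text \<open>The density of \<open>nu_r\<close> pulled back along the parametrization. Its values off
  \<open>coordinate_space K p\<close>, where it may be negative or use \<open>1 / 0 = 0\<close>, do
  not affect the measures computed below: the integrals are over subsets of that space.\<close>

definition coordinate_density ::
    "nat \<Rightarrow> (nat \<Rightarrow> nat) \<Rightarrow> real \<times> (nat \<Rightarrow> nat \<times> nat \<Rightarrow> real) \<Rightarrow> real" where
  "coordinate_density K p = (\<lambda>(a, x). 1 / a * (\<Prod>k=1..K. \<Prod>i=2..p k. x k (i, i) ^ (i - 2)))"

lemma space_full_lebesgue:
  "space (full_lebesgue K p) = UNIV \<times> (\<Pi>\<^sub>E k\<in>{1..K}. free_positions (p k) \<rightarrow>\<^sub>E UNIV)"
  by (simp add: full_lebesgue_def space_pair_measure space_PiM cong: PiE_cong del: One_nat_def)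

lemma borel_measurable_coordinate_density:
  "coordinate_density K p \<in> borel_measurable (full_lebesgue K p)"
proof -
  have entry: "(\<lambda>z. snd z k (i, i)) \<in> borel_measurable (full_lebesgue K p)"
    if k: "k \<in> {1..K}" and i: "i \<in> {2..p k}" for k i
  proof -
    have "(\<lambda>z. snd z k) \<in> full_lebesgue K p \<rightarrow>\<^sub>M (\<Pi>\<^sub>M ij\<in>free_positions (p k). lborel)"
      unfolding full_lebesgue_def
      by (rule measurable_compose[OF measurable_snd measurable_component_singleton[OF k]])
    moreover have "(\<lambda>x. x (i, i)) \<in> (\<Pi>\<^sub>M ij\<in>free_positions (p k). lborel) \<rightarrow>\<^sub>M (lborel :: real measure)"
      using i by (intro measurable_component_singleton) (simp add: free_positions_def)
    ultimately show ?thesis by (simp add: measurable_compose[of "\<lambda>z. snd z k"])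
  qed
  have [measurable]: "fst \<in> borel_measurable (full_lebesgue K p)"
    using measurable_fst[of "lborel :: real measure"] by (simp add: full_lebesgue_def)
  show ?thesis
    unfolding coordinate_density_def case_prod_unfold
    by (intro borel_measurable_times borel_measurable_prod borel_measurable_power entry) auto
qed

lemma scaled_triangular_groupD:
  assumes "T \<in> carrier (scaled_triangular_group K p)"
  shows "fst T > 0" "\<And>k. k \<in> {1..K} \<Longrightarrow> snd T k \<in> carrier (lower_triangular_group (p k))"
  using assms by (auto simp: scaled_triangular_group_def positive_reals_def)

lemma mult_scaled_triangular_group:
  "g \<otimes>\<^bsub>scaled_triangular_group K p\<^esub> h = (fst g * fst h, \<lambda>k\<in>{1..K}. snd g k * snd h k)"
  by (cases g; cases h)
    (simp add: scaled_triangular_group_def positive_reals_def lower_triangular_group_def)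

lemma scales_integral_coordinate_translation:
  assumes T: "T \<in> carrier (scaled_triangular_group K p)"
  shows "scales_integral (full_lebesgue K p) (coordinate_translation K p T)
    (fst T * (\<Prod>k=1..K. \<Prod>ij\<in>free_positions (p k). snd T k $$ (snd ij - 1, snd ij - 1)))"
  unfolding full_lebesgue_def coordinate_translation_def
proof (rule scales_integral_pair)
  interpret product_sigma_finite "\<lambda>_. lborel :: real measure" by standard
  have sf: "sigma_finite_measure (\<Pi>\<^sub>M ij\<in>free_positions q. (lborel :: real measure))" for q
    by (intro sigma_finite) simp
  note D = scaled_triangular_groupD[OF T]
  show "scales_integral lborel (\<lambda>a. a * fst T) (fst T)"
    using D(1) by (rule scales_integral_lborel_mult)
  show "scales_integral (\<Pi>\<^sub>M k\<in>{1..K}. \<Pi>\<^sub>M ij\<in>free_positions (p k). lborel)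
      (\<lambda>x. \<lambda>k\<in>{1..K}. entries_translation (p k) (snd T k) (x k))
      (\<Prod>k=1..K. \<Prod>ij\<in>free_positions (p k). snd T k $$ (snd ij - 1, snd ij - 1))"
  proof (rule scales_integral_PiM)
    fix k assume k: "k \<in> {1..K}"
    show "scales_integral (\<Pi>\<^sub>M ij\<in>free_positions (p k). lborel) (entries_translation (p k) (snd T k))
        (\<Prod>ij\<in>free_positions (p k). snd T k $$ (snd ij - 1, snd ij - 1))"
      using D(2)[OF k] by (rule scales_integral_entries_translation)
    show "0 \<le> (\<Prod>ij\<in>free_positions (p k). snd T k $$ (snd ij - 1, snd ij - 1))"
      by (intro prod_nonneg less_imp_le ballI lower_triangular_groupD(3)[OF D(2)[OF k]])
        (auto simp: free_positions_def)
  qed (simp_all add: sf)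
  show "sigma_finite_measure (\<Pi>\<^sub>M k\<in>{1..K}. \<Pi>\<^sub>M ij\<in>free_positions (p k). (lborel :: real measure))"
    by (intro product_sigma_finite.sigma_finite) (simp_all add: product_sigma_finite_def sf)
  show "0 \<le> fst T" using D(1) by simp
qed (rule sigma_finite_lborel)

text \<open>The density is a monomial in the scalar and the diagonal entries, each of which is
  multiplied by the corresponding entry of \<open>T\<close>. With \<open>1 / 0 = 0\<close> the
  identity also holds at \<open>a = 0\<close>.\<close>

lemma coordinate_density_translation:
  assumes T: "T \<in> carrier (scaled_triangular_group K p)"
  shows "coordinate_density K p (coordinate_translation K p T z) =
    1 / fst T * (\<Prod>k=1..K. \<Prod>i=2..p k. snd T k $$ (i - 1, i - 1) ^ (i - 2)) * coordinate_density K p z"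
proof -
  obtain a x where z: "z = (a, x)" by (cases z)
  have "(\<Prod>k=1..K. \<Prod>i=2..p k. entries_translation (p k) (snd T k) (x k) (i, i) ^ (i - 2)) =
      (\<Prod>k=1..K. \<Prod>i=2..p k. x k (i, i) ^ (i - 2) * snd T k $$ (i - 1, i - 1) ^ (i - 2))"
    using scaled_triangular_groupD(2)[OF T]
    by (intro prod.cong refl) (simp add: entries_translation_diagonal power_mult_distrib)
  then show ?thesis
    by (simp add: z coordinate_density_def coordinate_translation_def prod.distrib mult_ac)
qed

lemma coordinate_translation_jacobian:
  assumes p: "\<And>k. k \<in> {1..K} \<Longrightarrow> p k \<ge> 1" and T: "T \<in> carrier (scaled_triangular_group K p)"
  shows "(fst T * (\<Prod>k=1..K. \<Prod>ij\<in>free_positions (p k). snd T k $$ (snd ij - 1, snd ij - 1))) *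
    (1 / fst T * (\<Prod>k=1..K. \<Prod>i=2..p k. snd T k $$ (i - 1, i - 1) ^ (i - 2))) = 1"
proof -
  have "(\<Prod>k=1..K. (\<Prod>ij\<in>free_positions (p k). snd T k $$ (snd ij - 1, snd ij - 1)) *
      (\<Prod>i=2..p k. snd T k $$ (i - 1, i - 1) ^ (i - 2))) = 1"
    using scaled_triangular_groupD(2)[OF T] p
    by (intro prod.neutral ballI entries_translation_jacobian) auto
  then show ?thesis
    using scaled_triangular_groupD(1)[OF T] by (simp add: prod.distrib mult_ac)
qed

text \<open>Invariance in coordinates: the Jacobian \<open>J\<close> of the translation and the
  factor \<open>d\<close> gained by the density cancel.\<close>

lemma nn_integral_coordinate_translation:
  assumes p: "\<And>k. k \<in> {1..K} \<Longrightarrow> p k \<ge> 1" and T: "T \<in> carrier (scaled_triangular_group K p)"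
    and f [measurable]: "f \<in> borel_measurable (full_lebesgue K p)"
  shows "(\<integral>\<^sup>+z. ennreal (coordinate_density K p z) * f (coordinate_translation K p T z) \<partial>full_lebesgue K p)
    = (\<integral>\<^sup>+z. ennreal (coordinate_density K p z) * f z \<partial>full_lebesgue K p)"
proof -
  let ?w = "coordinate_density K p" and ?\<Phi> = "coordinate_translation K p T" and ?M = "full_lebesgue K p"
  define J where "J = fst T * (\<Prod>k=1..K. \<Prod>ij\<in>free_positions (p k). snd T k $$ (snd ij - 1, snd ij - 1))"
  define d where "d = 1 / fst T * (\<Prod>k=1..K. \<Prod>i=2..p k. snd T k $$ (i - 1, i - 1) ^ (i - 2))"
  note scales = scales_integral_coordinate_translation[OF T, folded J_def]
  have [measurable]: "?\<Phi> \<in> ?M \<rightarrow>\<^sub>M ?M" using scales by (rule scales_integral_measurable)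
  have [measurable]: "?w \<in> borel_measurable ?M"
    by (rule borel_measurable_coordinate_density)
  have "0 \<le> snd T k $$ (i - 1, i - 1) ^ (i - 2)" if "k \<in> {1..K}" "i \<in> {2..p k}" for k i
    using lower_triangular_groupD(3)[OF scaled_triangular_groupD(2)[OF T that(1)], of "i - 1"] that
    by (intro zero_le_power less_imp_le) auto
  then have d: "0 \<le> d"
    unfolding d_def using scaled_triangular_groupD(1)[OF T]
    by (intro mult_nonneg_nonneg prod_nonneg) auto
  have one: "J * d = 1"
    unfolding J_def d_def by (rule coordinate_translation_jacobian[OF p T])
  \<comment> \<open>\<open>J * d = 1\<close> with \<open>d \<ge> 0\<close> forces
    \<open>J > 0\<close>; the signs are needed to merge the two factors inside
    \<open>ennreal\<close>.\<close>
  from d one have J: "0 \<le> J" using zero_less_mult_iff[of J d] by auto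
  have "(\<integral>\<^sup>+z. ennreal (?w z) * f z \<partial>?M) = ennreal J * (\<integral>\<^sup>+z. ennreal (?w (?\<Phi> z)) * f (?\<Phi> z) \<partial>?M)"
    by (rule nn_integral_scales_integral[OF scales]) measurable
  also have "(\<integral>\<^sup>+z. ennreal (?w (?\<Phi> z)) * f (?\<Phi> z) \<partial>?M) =
      (\<integral>\<^sup>+z. ennreal d * (ennreal (?w z) * f (?\<Phi> z)) \<partial>?M)"
    using d by (simp add: coordinate_density_translation[OF T, folded d_def] ennreal_mult' mult.assoc)
  also have "\<dots> = ennreal d * (\<integral>\<^sup>+z. ennreal (?w z) * f (?\<Phi> z) \<partial>?M)"
    by (rule nn_integral_cmult) measurable
  finally show ?thesis
    using J d one by (simp flip: mult.assoc ennreal_mult)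
qed

section \<open>Translations on the coordinate space and the group law\<close>

text \<open>The backward direction keeps preimages, taken in the full space, of subsets of the
  coordinate space inside it.\<close>

lemma coordinate_translation_in_coordinate_space_iff:
  assumes T: "T \<in> carrier (scaled_triangular_group K p)" and z: "z \<in> space (full_lebesgue K p)"
  shows "coordinate_translation K p T z \<in> coordinate_space K p \<longleftrightarrow> z \<in> coordinate_space K p"
proof -
  obtain a x where ax: "z = (a, x)" by (cases z)
  have "entries_translation (p k) (snd T k) (x k) \<in> free_entries (p k) \<longleftrightarrow> x k \<in> free_entries (p k)"
    if "k \<in> {1..K}" for k
    using scaled_triangular_groupD(2)[OF T that] z that
    by (intro entries_translation_in_free_entries_iff) (auto simp: ax space_full_lebesgue)
  moreover have "x \<in> extensional {1..K}" using z by (auto simp: ax space_full_lebesgue PiE_def)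
  ultimately show ?thesis
    using scaled_triangular_groupD(1)[OF T]
    by (auto simp: ax coordinate_translation_def coordinate_space_def PiE_iff zero_less_mult_iff)
qed

lemma parametrization_translation:
  assumes p: "\<And>k. k \<in> {1..K} \<Longrightarrow> p k \<ge> 1" and T: "T \<in> carrier (scaled_triangular_group K p)"
    and z: "z \<in> coordinate_space K p"
  shows "parametrization K p (coordinate_translation K p T z) =
    parametrization K p z \<otimes>\<^bsub>scaled_triangular_group K p\<^esub> T"
proof -
  obtain a x where ax: "z = (a, x)" by (cases z)
  have "matrix_of_entries (p k) (entries_translation (p k) (snd T k) (x k)) =
      matrix_of_entries (p k) (x k) * snd T k" if "k \<in> {1..K}" for k
    using scaled_triangular_groupD(2)[OF T that] p[OF that] z that
    by (intro matrix_of_entries_translation) (auto simp: ax coordinate_space_def)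
  then show ?thesis
    by (auto simp: ax parametrization_def coordinate_translation_def mult_scaled_triangular_group
        restrict_def)
qed

lemma coordinate_space_subset_space: "coordinate_space K p \<subseteq> space (full_lebesgue K p)"
  unfolding coordinate_space_def space_full_lebesgue
  by (intro Sigma_mono subset_UNIV PiE_mono) (auto simp: free_entries_def)

text \<open>Read off from the group: both sides have the same image under the parametrization
  because \<open>T\<close> and \<open>S\<close> cancel, and the parametrization is
  injective.\<close>

lemma coordinate_translation_inverse:
  assumes p: "\<And>k. k \<in> {1..K} \<Longrightarrow> p k \<ge> 1"
    and T: "T \<in> carrier (scaled_triangular_group K p)" and S: "S \<in> carrier (scaled_triangular_group K p)"
    and TS: "T \<otimes>\<^bsub>scaled_triangular_group K p\<^esub> S = \<one>\<^bsub>scaled_triangular_group K p\<^esub>"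
    and z: "z \<in> coordinate_space K p"
  shows "coordinate_translation K p S (coordinate_translation K p T z) = z"
proof -
  interpret group "scaled_triangular_group K p" by (rule group_scaled_triangular_group)
  let ?G = "scaled_triangular_group K p"
  note bij = bij_betw_parametrization[of K p, OF p]
  have Tz: "coordinate_translation K p T z \<in> coordinate_space K p"
    using coordinate_translation_in_coordinate_space_iff[OF T] z coordinate_space_subset_space by blast
  then have STz: "coordinate_translation K p S (coordinate_translation K p T z) \<in> coordinate_space K p"
    using coordinate_translation_in_coordinate_space_iff[OF S] coordinate_space_subset_space by blast
  have Pz: "parametrization K p z \<in> carrier ?G"
    using bij z by (rule bij_betw_apply)
  have "parametrization K p (coordinate_translation K p S (coordinate_translation K p T z)) =
      parametrization K p z \<otimes>\<^bsub>?G\<^esub> T \<otimes>\<^bsub>?G\<^esub> S"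
    by (simp only: parametrization_translation[OF p S Tz] parametrization_translation[OF p T z])
  also have "\<dots> = parametrization K p z" using Pz T S by (simp add: m_assoc TS)
  finally show ?thesis
    using bij_betw_imp_inj_on[OF bij] STz z by (auto dest: inj_onD)
qed

text \<open>Turning the image into a preimage under the inverse translation gives its measurability
  and expresses its indicator as a composition.\<close>

lemma image_coordinate_translation:
  assumes p: "\<And>k. k \<in> {1..K} \<Longrightarrow> p k \<ge> 1"
    and T: "T \<in> carrier (scaled_triangular_group K p)" and C: "C \<subseteq> coordinate_space K p"
  shows "coordinate_translation K p T ` C =
    coordinate_translation K p (inv\<^bsub>scaled_triangular_group K p\<^esub> T) -` C \<inter> space (full_lebesgue K p)"
    (is "?\<Phi> T ` C = ?\<Phi> ?S -` C \<inter> space ?M")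
proof -
  interpret group "scaled_triangular_group K p" by (rule group_scaled_triangular_group)
  have S: "?S \<in> carrier (scaled_triangular_group K p)" using T by (rule inv_closed)
  show ?thesis
  proof (intro equalityI subsetI)
    fix z assume "z \<in> ?\<Phi> T ` C"
    then obtain c where c: "c \<in> C" "z = ?\<Phi> T c" by blast
    moreover have "?\<Phi> ?S (?\<Phi> T c) = c"
      using c(1) C T by (intro coordinate_translation_inverse p S) auto
    moreover have "?\<Phi> T c \<in> coordinate_space K p"
      using coordinate_translation_in_coordinate_space_iff[OF T] c(1) C coordinate_space_subset_space
      by blast
    ultimately show "z \<in> ?\<Phi> ?S -` C \<inter> space ?M"
      using coordinate_space_subset_space by auto
  next
    fix z assume z: "z \<in> ?\<Phi> ?S -` C \<inter> space ?M"
    then have "z \<in> coordinate_space K p"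
      using coordinate_translation_in_coordinate_space_iff[OF S, of z] C by blast
    then have "?\<Phi> T (?\<Phi> ?S z) = z"
      using T by (intro coordinate_translation_inverse p S) auto
    then show "z \<in> ?\<Phi> T ` C" using z by (metis IntD1 imageI vimageD)
  qed
qed

section \<open>Restriction to the coordinate space and transport to the group\<close>

lemma coordinate_lebesgue_eq:
  "coordinate_lebesgue K p = restrict_space (full_lebesgue K p) (coordinate_space K p)"
  by (simp only: coordinate_lebesgue_def full_lebesgue_def)

lemma space_coordinate_lebesgue: "space (coordinate_lebesgue K p) = coordinate_space K p"
  using coordinate_space_subset_space[of K p] by (auto simp: coordinate_lebesgue_eq space_restrict_space)

lemma coordinate_space_in_sets: "coordinate_space K p \<in> sets (full_lebesgue K p)"
  unfolding full_lebesgue_def by (rule sets_coordinate_space)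

lemma inj_on_parametrization_space:
  assumes "\<And>k. k \<in> {1..K} \<Longrightarrow> p k \<ge> 1"
  shows "inj_on (parametrization K p) (space (coordinate_lebesgue K p))"
  unfolding space_coordinate_lebesgue
  by (rule bij_betw_imp_inj_on[OF bij_betw_parametrization[of K p, OF assms]])

lemma sets_coordinate_lebesgue:
  "C \<in> sets (coordinate_lebesgue K p) \<longleftrightarrow> C \<in> sets (full_lebesgue K p) \<and> C \<subseteq> coordinate_space K p"
  using coordinate_space_in_sets[of K p] coordinate_space_subset_space[of K p]
  by (auto simp: coordinate_lebesgue_eq sets_restrict_space_iff Int_absorb2)

text \<open>Brings \<open>nu_r\<close> back to full Lebesgue measure: the density is pulled back
  along the injective parametrization, and the restriction is absorbed by the indicator of
  \<open>C\<close>.\<close>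

lemma emeasure_nu_r_image:
  assumes p: "\<And>k. k \<in> {1..K} \<Longrightarrow> p k \<ge> 1" and C: "C \<in> sets (coordinate_lebesgue K p)"
  shows "emeasure (nu_r K p) (parametrization K p ` C) =
    (\<integral>\<^sup>+z. ennreal (coordinate_density K p z) * indicator C z \<partial>full_lebesgue K p)"
proof -
  let ?P = "parametrization K p" and ?w = "coordinate_density K p"
  let ?L = "coordinate_lebesgue K p" and ?M = "full_lebesgue K p" and ?\<Omega> = "coordinate_space K p"
  let ?h = "\<lambda>(a, A). ennreal (1 / a * (\<Prod>k=1..K. \<Prod>i=2..p k. A k $$ (i - 1, i - 1) ^ (i - 2)))"
  note inj = inj_on_parametrization_space[of K p, OF p]
  note L = coordinate_lebesgue_eq[of K p]
  \<comment> \<open>For \<open>i \<ge> 2\<close> the diagonal entry is free; only the first one is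
    determined by the others.\<close>
  have entry: "matrix_of_entries q x $$ (i - 1, i - 1) = x (i, i)" if "i \<in> {2..q}" for q x i
    using that by (auto simp: matrix_of_entries_def)
  have h: "?h (?P z) = ennreal (?w z)" for z
  proof -
    obtain a x where z: "z = (a, x)" by (cases z)
    have "(\<Prod>k=1..K. \<Prod>i=2..p k. snd (?P z) k $$ (i - 1, i - 1) ^ (i - 2)) =
        (\<Prod>k=1..K. \<Prod>i=2..p k. x k (i, i) ^ (i - 2))"
      by (intro prod.cong refl) (simp add: z parametrization_def entry del: One_nat_def)
    then show ?thesis
      by (simp add: z parametrization_def coordinate_density_def del: One_nat_def)
  qed
  have "(\<lambda>z. ennreal (?w z)) \<in> borel_measurable ?L"
    unfolding L by (intro measurable_restrict_space1 measurable_compose[OF borel_measurable_coordinate_density]) simp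
  \<comment> \<open>Measurability on an embedded measure is tested after composition with the
    embedding, where \<open>h\<close> identifies the function as the coordinate density.\<close>
  then have h_meas [measurable]: "?h \<in> borel_measurable (group_lebesgue K p)"
    unfolding group_lebesgue_def by (intro measurable_embed_measure1) (simp only: h)
  have PC [measurable]: "?P ` C \<in> sets (group_lebesgue K p)"
    unfolding group_lebesgue_def by (rule in_sets_embed_measure[OF C])
  have "emeasure (nu_r K p) (?P ` C) = (\<integral>\<^sup>+g. ?h g * indicator (?P ` C) g \<partial>group_lebesgue K p)"
    unfolding nu_r_def by (rule emeasure_density[OF h_meas PC])
  also have "\<dots> = (\<integral>\<^sup>+z. ?h (?P z) * indicator (?P ` C) (?P z) \<partial>?L)"
    unfolding group_lebesgue_def
    by (intro nn_integral_embed_measure'[OF inj], fold group_lebesgue_def) measurable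
  also have "\<dots> = (\<integral>\<^sup>+z. ennreal (?w z) * indicator C z \<partial>?L)"
  proof (rule nn_integral_cong)
    fix z assume z: "z \<in> space ?L"
    have "?P z \<in> ?P ` C \<longleftrightarrow> z \<in> C"
      by (rule inj_on_image_mem_iff[OF inj z sets.sets_into_space[OF C]])
    then show "?h (?P z) * indicator (?P ` C) (?P z) = ennreal (?w z) * indicator C z"
      by (simp only: h indicator_def)
  qed
  also have "\<dots> = (\<integral>\<^sup>+z. ennreal (?w z) * indicator C z * indicator ?\<Omega> z \<partial>?M)"
    unfolding L using coordinate_space_in_sets[of K p]
    by (intro nn_integral_restrict_space) (rule sets.Int[OF _ sets.top])
  also have "\<dots> = (\<integral>\<^sup>+z. ennreal (?w z) * indicator C z \<partial>?M)"
    using C by (intro nn_integral_cong) (auto simp: sets_coordinate_lebesgue indicator_def)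
  finally show ?thesis .
qed

theorem theorem1:
  fixes K :: nat and p :: "nat \<Rightarrow> nat"
  assumes "K \<ge> 1"
    and "\<And>k. k \<in> {1..K} \<Longrightarrow> p k \<ge> 1"
  shows "right_invariant_measure (scaled_triangular_group K p) (nu_r K p)"
  unfolding right_invariant_measure_def
proof (intro conjI ballI)
  let ?G = "scaled_triangular_group K p" and ?P = "parametrization K p"
  let ?L = "coordinate_lebesgue K p" and ?M = "full_lebesgue K p"
  note p = assms(2)
  note bij = bij_betw_parametrization[of K p, OF p]
  note inj = inj_on_parametrization_space[of K p, OF p]
  interpret group ?G by (rule group_scaled_triangular_group)
  show "space (nu_r K p) = carrier ?G"
    using bij_betw_imp_surj_on[OF bij]
    by (simp add: nu_r_def group_lebesgue_def space_embed_measure space_coordinate_lebesgue)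
  \<comment> \<open>By injectivity the measurable sets of the group are exactly the images of
    measurable coordinate sets, so \<open>B\<close> comes from a measurable
    \<open>C\<close>.\<close>
  have sets_nu: "sets (nu_r K p) = (`) ?P ` sets ?L"
    using sets_embed_measure'[OF inj] by (auto simp: nu_r_def group_lebesgue_def)
  fix T B assume T: "T \<in> carrier ?G" and "B \<in> sets (nu_r K p)"
  then obtain C where C: "C \<in> sets ?L" and B: "B = ?P ` C" unfolding sets_nu by blast
  let ?S = "inv\<^bsub>?G\<^esub> T"
  have S: "?S \<in> carrier ?G" using T by (rule inv_closed)
  \<comment> \<open>The translate of \<open>B\<close> seen in coordinates.\<close>
  define D where "D = coordinate_translation K p T ` C"
  have C_sub: "C \<subseteq> coordinate_space K p" using C by (simp add: sets_coordinate_lebesgue)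
  have D_eq: "D = coordinate_translation K p ?S -` C \<inter> space ?M"
    unfolding D_def by (rule image_coordinate_translation[OF p T C_sub])
  have "D \<subseteq> coordinate_space K p"
    using coordinate_translation_in_coordinate_space_iff[OF T] C_sub coordinate_space_subset_space
    unfolding D_def by blast
  moreover have "D \<in> sets ?M"
    unfolding D_eq using C scales_integral_coordinate_translation[OF S]
    by (intro measurable_sets[OF scales_integral_measurable]) (auto simp: sets_coordinate_lebesgue)
  ultimately have D: "D \<in> sets ?L" by (simp add: sets_coordinate_lebesgue)
  have BT: "B #>\<^bsub>?G\<^esub> T = ?P ` D"
    using C_sub parametrization_translation[OF p T]
    unfolding B D_def r_coset_def by force
  show "B #>\<^bsub>?G\<^esub> T \<in> sets (nu_r K p)"
    unfolding BT sets_nu using D by (rule imageI)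
  have "emeasure (nu_r K p) (B #>\<^bsub>?G\<^esub> T) =
      (\<integral>\<^sup>+z. ennreal (coordinate_density K p z) * indicator D z \<partial>?M)"
    unfolding BT by (rule emeasure_nu_r_image[OF p D])
  also have "\<dots> = (\<integral>\<^sup>+z. ennreal (coordinate_density K p z) *
      indicator C (coordinate_translation K p ?S z) \<partial>?M)"
    by (intro nn_integral_cong) (auto simp: D_eq indicator_def)
  \<comment> \<open>Invariance is applied to the inverse translation \<open>?S\<close>, with the
    indicator of \<open>C\<close> as test function.\<close>
  also have "\<dots> = (\<integral>\<^sup>+z. ennreal (coordinate_density K p z) * indicator C z \<partial>?M)"
    using C by (intro nn_integral_coordinate_translation[OF p S]) (auto simp: sets_coordinate_lebesgue)
  also have "\<dots> = emeasure (nu_r K p) B"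
    unfolding B by (rule emeasure_nu_r_image[OF p C, symmetric])
  finally show "emeasure (nu_r K p) (B #>\<^bsub>?G\<^esub> T) = emeasure (nu_r K p) B" .
qed

end
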